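(* Let $h:[0,1]\to\mathbb{R}$ be the binary entropy function $h(x)=-x\log x-(1-x)\log(1-x)$. Then for every real number $q\in(0,1/2)$ and every integer $n\geq 2$, setting $p=1-q$, one has the strict inequality $$p^n\,(1+q^n-p^n)\,h(q^n)>q^n\,(1+p^n-q^n)\,h(p^n).$$
   Context: Here $\log$ denotes the natural logarithm (the inequality does not depend on the choice of base $>1$), and the usual convention $0\log 0=0$ is used to define $h$ at the endpoints $0$ and $1$. *)

theory Defs
  imports Complex_Main
begin

(* Only the values on the interval [0,1] are meaningful.  At the endpoints the factor 0
   makes 0 * ln 0 = 0 hold, which is the usual convention 0 log 0 = 0. *)
definition bin_entropy :: "real \<Rightarrow> real" where
  "bin_entropy x = - x * ln x - (1 - x) * ln (1 - x)"

end

theory Submission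
  imports Defs
begin

text \<open>
  Write \<open>h\<close> for the binary entropy and \<open>g x = h x / x\<close>.  With \<open>d = p^n - q^n\<close> the claim says that
  \<open>g (q^n) / g (p^n) > (1 + d) / (1 - d)\<close>.  For exponent \<open>1\<close> both sides equal \<open>p / q\<close>, because
  \<open>h q = h p\<close> and \<open>p - q\<close> plays the role of \<open>d\<close>.  When the exponent grows, the right side does
  not increase, since \<open>p^n - q^n \<le> p - q\<close>, so it is enough that the left side strictly increases.

  For a real exponent \<open>t\<close>, the logarithmic derivative of the left side is
  \<open>(E (q^t) - E (p^t)) / t\<close>, where \<open>E x = ln x * ln (1 - x) / h x\<close> happens to be symmetric under
  \<open>x \<mapsto> 1 - x\<close>.  Moreover \<open>1 / E x = \<psi> x + \<psi> (1 - x)\<close> with \<open>\<psi> x = (x - 1) / ln x\<close>, the logarithmic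
  mean of \<open>x\<close> and \<open>1\<close>.  As \<open>\<psi>\<close> is strictly concave, \<open>1 / E\<close> is strictly larger at the point closer
  to \<open>1/2\<close>.  For \<open>t > 1\<close> we have \<open>q^t < p^t\<close> and \<open>q^t + p^t < 1\<close>, so \<open>p^t\<close> is that point, and the
  derivative is positive.
\<close>

section \<open>The logarithmic mean\<close>

definition log_mean_one :: "real \<Rightarrow> real" where
  "log_mean_one x = (x - 1) / ln x"

text \<open>The difference of the two sides vanishes at \<open>1\<close> and has derivative
  \<open>(x - 1)\<^sup>2 / (x * (x + 1)\<^sup>2)\<close>.\<close>

lemma ln_less_pade:
  fixes x :: real
  assumes "0 < x" "x < 1"
  shows "ln x < 2 * (x - 1) / (x + 1)"
proof -
  let ?r = "\<lambda>x::real. ln x - 2 * (x - 1) / (x + 1)"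
  have "?r x < ?r 1"
  proof (rule DERIV_pos_imp_increasing_open[OF \<open>x < 1\<close>])
    fix z assume z: "x < z" "z < 1"
    with assms have "0 < z" by simp
    have "(?r has_real_derivative (1 / z - (2 * (z + 1) - 2 * (z - 1)) / (z + 1)\<^sup>2)) (at z)"
      using \<open>0 < z\<close> by (auto intro!: derivative_eq_intros simp: power2_eq_square)
    moreover have "1 / z - (2 * (z + 1) - 2 * (z - 1)) / (z + 1)\<^sup>2 = (z - 1)\<^sup>2 / (z * (z + 1)\<^sup>2)"
      using \<open>0 < z\<close> by (simp add: divide_simps) (simp add: power2_eq_square algebra_simps)
    moreover have "0 < (z - 1)\<^sup>2 / (z * (z + 1)\<^sup>2)"
      using z \<open>0 < z\<close> by (intro divide_pos_pos mult_pos_pos) auto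
    ultimately show "\<exists>D. (?r has_real_derivative D) (at z) \<and> 0 < D" by metis
  qed (use assms in \<open>auto intro!: continuous_intros\<close>)
  then show ?thesis by simp
qed

lemma has_derivative_log_mean_one:
  assumes "0 < x" "x < 1"
  shows "(log_mean_one has_real_derivative (ln x - 1 + 1 / x) / (ln x)\<^sup>2) (at x)"
  unfolding log_mean_one_def[abs_def] using assms
  by (auto intro!: derivative_eq_intros simp: power2_eq_square field_simps)

text \<open>This is the strict concavity of \<open>log_mean_one\<close>: the second derivative is
  \<open>(2 * (x - 1) - (x + 1) * ln x) / (x\<^sup>2 * (ln x)^3)\<close>, whose numerator is positive by
  \<open>ln_less_pade\<close> and whose denominator is negative.\<close>

lemma log_mean_one_deriv_strict_antimono:
  fixes a b :: real
  assumes "0 < a" "a < b" "b < 1"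
  shows "(ln b - 1 + 1 / b) / (ln b)\<^sup>2 < (ln a - 1 + 1 / a) / (ln a)\<^sup>2"
proof (rule DERIV_neg_imp_decreasing[OF \<open>a < b\<close>])
  fix x assume "a \<le> x" "x \<le> b"
  with assms have x: "0 < x" "x < 1" by auto
  then have ln: "ln x < 0" by simp
  let ?D = "(2 * (x - 1) - (x + 1) * ln x) / (x\<^sup>2 * (ln x)^3)"
  have "((\<lambda>x. (ln x - 1 + 1 / x) / (ln x)\<^sup>2) has_real_derivative
      ((1 / x - 1 / x\<^sup>2) * (ln x)\<^sup>2 - (ln x - 1 + 1 / x) * (2 * ln x * (1 / x))) / ((ln x)\<^sup>2 * (ln x)\<^sup>2)) (at x)"
    using x by (auto intro!: derivative_eq_intros simp: power2_eq_square)
  also have "((1 / x - 1 / x\<^sup>2) * (ln x)\<^sup>2 - (ln x - 1 + 1 / x) * (2 * ln x * (1 / x))) / ((ln x)\<^sup>2 * (ln x)\<^sup>2) = ?D"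
    using x ln by (simp add: divide_simps) (simp add: eval_nat_numeral algebra_simps)
  finally have "((\<lambda>x. (ln x - 1 + 1 / x) / (ln x)\<^sup>2) has_real_derivative ?D) (at x)" .
  moreover have "?D < 0"
  proof (rule divide_pos_neg)
    show "0 < 2 * (x - 1) - (x + 1) * ln x"
      using ln_less_pade[OF x] x by (simp add: field_simps)
    show "x\<^sup>2 * (ln x)^3 < 0"
      using x ln by (simp add: mult_pos_neg power3_eq_cube mult_neg_neg)
  qed
  ultimately show "\<exists>D. ((\<lambda>x. (ln x - 1 + 1 / x) / (ln x)\<^sup>2) has_real_derivative D) (at x) \<and> D < 0"
    by blast
qed

lemma log_mean_one_reflect_sum_strict_mono:
  assumes "0 < x" "x < y" "y \<le> 1 / 2"
  shows "log_mean_one x + log_mean_one (1 - x) < log_mean_one y + log_mean_one (1 - y)"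
proof (rule DERIV_pos_imp_increasing_open[OF \<open>x < y\<close>])
  let ?W = "\<lambda>z. log_mean_one z + log_mean_one (1 - z)"
  let ?d = "\<lambda>x::real. (ln x - 1 + 1 / x) / (ln x)\<^sup>2"
  have deriv: "(?W has_real_derivative ?d z - ?d (1 - z)) (at z)" if "0 < z" "z < 1" for z
  proof -
    have "((\<lambda>z. log_mean_one (1 - z)) has_real_derivative ?d (1 - z) * (- 1)) (at z)"
      by (rule DERIV_chain2[of log_mean_one])
        (use that in \<open>auto intro!: has_derivative_log_mean_one derivative_eq_intros\<close>)
    from DERIV_add[OF has_derivative_log_mean_one[OF that] this] show ?thesis
      by simp
  qed
  fix z assume "x < z" "z < y"
  with assms have "0 < z" "z < 1 - z" by auto
  then show "\<exists>D. (?W has_real_derivative D) (at z) \<and> 0 < D"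
    using deriv[of z] log_mean_one_deriv_strict_antimono[of z "1 - z"] by force
next
  let ?W = "\<lambda>z. log_mean_one z + log_mean_one (1 - z)"
  have "isCont ?W z" if "0 < z" "z < 1" for z
    unfolding log_mean_one_def using that by (auto intro!: continuous_intros)
  then show "continuous_on {x..y} ?W"
    using assms by (intro continuous_at_imp_continuous_on) auto
qed

text \<open>The hypotheses say that \<open>y\<close> is closer to \<open>1/2\<close> than \<open>x\<close>.\<close>

lemma log_mean_one_reflect_sum_less:
  assumes "0 < x" "x < y" "x + y < 1"
  shows "log_mean_one x + log_mean_one (1 - x) < log_mean_one y + log_mean_one (1 - y)"
proof (cases "y \<le> 1 / 2")
  case True
  then show ?thesis using assms log_mean_one_reflect_sum_strict_mono by blast
next
  case False
  then show ?thesis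
    using assms log_mean_one_reflect_sum_strict_mono[of x "1 - y"] by simp
qed

section \<open>Binary entropy along powers\<close>

lemma bin_entropy_pos:
  assumes "0 < x" "x < 1"
  shows "0 < bin_entropy x"
proof -
  have "x * ln x < 0" "(1 - x) * ln (1 - x) < 0"
    using assms by (auto intro!: mult_pos_neg)
  then show ?thesis unfolding bin_entropy_def by simp
qed

lemma bin_entropy_reflect: "bin_entropy (1 - x) = bin_entropy x"
  by (simp add: bin_entropy_def algebra_simps)

lemma ln_mult_ln_div_bin_entropy:
  assumes "0 < x" "x < 1"
  shows "ln x * ln (1 - x) / bin_entropy x = 1 / (log_mean_one x + log_mean_one (1 - x))"
proof -
  have "ln x \<noteq> 0" "ln (1 - x) \<noteq> 0" using assms by auto
  then have "log_mean_one x + log_mean_one (1 - x) = bin_entropy x / (ln x * ln (1 - x))"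
    unfolding log_mean_one_def bin_entropy_def by (simp add: field_simps)
  then show ?thesis by simp
qed

lemma ln_mult_ln_div_bin_entropy_less:
  assumes "0 < x" "x < y" "x + y < 1"
  shows "ln y * ln (1 - y) / bin_entropy y < ln x * ln (1 - x) / bin_entropy x"
proof -
  have pos: "0 < log_mean_one x + log_mean_one (1 - x)"
    unfolding log_mean_one_def using assms by (intro add_pos_pos divide_neg_neg) auto
  show ?thesis
    using assms log_mean_one_reflect_sum_less[OF assms] pos
    by (simp add: ln_mult_ln_div_bin_entropy frac_less2)
qed

text \<open>The derivative of \<open>bin_entropy\<close> at \<open>x\<close> is \<open>ln (1 - x) - ln x\<close>, and
  \<open>x * (ln (1 - x) - ln x) - bin_entropy x\<close> collapses to \<open>ln (1 - x)\<close>; the result is put in a form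
  in which \<open>c\<close> and \<open>t\<close> enter only through \<open>c powr t\<close> and the factor \<open>1 / t\<close>.\<close>

lemma has_derivative_ln_bin_entropy_powr:
  fixes c t :: real
  assumes "0 < c" "c < 1" "0 < t"
  defines "x \<equiv> c powr t"
  shows "((\<lambda>t. ln (bin_entropy (c powr t)) - t * ln c) has_real_derivative
      ln x * ln (1 - x) / bin_entropy x / t) (at t)"
proof -
  have x: "0 < x" "x < 1"
    using assms by (auto simp: powr01_less_one)
  have powr: "((\<lambda>t. c powr t) has_real_derivative x * ln c) (at t)"
    using assms by (auto intro!: derivative_eq_intros)
  have "(bin_entropy has_real_derivative ln (1 - x) - ln x) (at x)"
    unfolding bin_entropy_def[abs_def] using x
    by (auto intro!: derivative_eq_intros)
  then have "((\<lambda>t. bin_entropy (c powr t)) has_real_derivative (ln (1 - x) - ln x) * (x * ln c)) (at t)"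
    unfolding x_def by (rule DERIV_chain2) (use powr x_def in simp)
  then have "((\<lambda>t. ln (bin_entropy (c powr t)) - t * ln c) has_real_derivative
      1 / bin_entropy x * ((ln (1 - x) - ln x) * (x * ln c)) - ln c) (at t)"
    using bin_entropy_pos[OF x] unfolding x_def
    by (auto intro!: derivative_eq_intros DERIV_ln_divide)
  moreover have "1 / bin_entropy x * ((ln (1 - x) - ln x) * (x * ln c)) - ln c
      = ln c * ((ln (1 - x) - ln x) * x - bin_entropy x) / bin_entropy x"
    using bin_entropy_pos[OF x] by (simp add: field_simps)
  moreover have "(ln (1 - x) - ln x) * x - bin_entropy x = ln (1 - x)"
    by (simp add: bin_entropy_def algebra_simps)
  moreover have "ln c = ln x / t"
    using assms by (simp add: x_def ln_powr)
  ultimately show ?thesis by (simp add: mult.commute)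
qed

text \<open>The logarithm of the ratio of \<open>bin_entropy (q powr t) / q powr t\<close> to
  \<open>bin_entropy (p powr t) / p powr t\<close> is strictly increasing on \<open>t \<ge> 1\<close>; at \<open>t = 1\<close> the ratio is
  \<open>p / q\<close> by the symmetry of the entropy.\<close>

lemma bin_entropy_powr_ratio:
  fixes p q s :: real
  assumes q: "0 < q" "q < p" and pq: "p + q = 1" and s: "1 < s"
  shows "p / q * (bin_entropy (p powr s) / p powr s) < bin_entropy (q powr s) / q powr s"
proof -
  let ?A = "\<lambda>c t. ln (bin_entropy (c powr t)) - t * ln c"
  let ?E = "\<lambda>x. ln x * ln (1 - x) / bin_entropy x"
  have p: "0 < p" "p < 1" "q < 1" using q pq by auto
  have deriv: "((\<lambda>t. ?A q t - ?A p t) has_real_derivative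
      ?E (q powr t) / t - ?E (p powr t) / t) (at t)" if "1 \<le> t" for t
    by (intro DERIV_diff[of "?A q" _ _ _ "?A p"] has_derivative_ln_bin_entropy_powr)
      (use q p that in auto)
  have "?A q 1 - ?A p 1 < ?A q s - ?A p s"
  proof (rule DERIV_pos_imp_increasing_open[OF s])
    fix t assume "1 < t" "t < s"
    have "q powr t < q" "p powr t < p"
      using \<open>1 < t\<close> q p powr_less_mono'[of q 1 t] powr_less_mono'[of p 1 t] by auto
    then have "?E (p powr t) < ?E (q powr t)"
      using q pq \<open>1 < t\<close> by (intro ln_mult_ln_div_bin_entropy_less powr_less_mono2) auto
    then have "0 < ?E (q powr t) / t - ?E (p powr t) / t"
      using \<open>1 < t\<close> divide_strict_right_mono[of _ _ t] by fastforce
    then show "\<exists>D. ((\<lambda>t. ?A q t - ?A p t) has_real_derivative D) (at t) \<and> 0 < D"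
      using deriv \<open>1 < t\<close> by (meson less_imp_le)
  next
    show "continuous_on {1..s} (\<lambda>t. ?A q t - ?A p t)"
      by (intro continuous_at_imp_continuous_on ballI DERIV_isCont[OF deriv]) simp
  qed
  moreover have "bin_entropy q = bin_entropy p"
    using bin_entropy_reflect[of p] pq by (metis add_diff_cancel_left')
  ultimately have *: "ln p - ln q + ?A p s < ?A q s"
    using q p by simp
  have pos: "0 < bin_entropy (c powr s)" if "0 < c" "c < 1" for c
    using that s by (intro bin_entropy_pos) (auto simp: powr01_less_one)
  have "ln (p / q * (bin_entropy (p powr s) / p powr s)) < ln (bin_entropy (q powr s) / q powr s)"
    using * pos[of p] pos[of q] q p by (simp add: ln_div ln_mult ln_powr)
  then show ?thesis
    using pos[of p] pos[of q] q p by simp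
qed

section \<open>The inequality for integer exponents\<close>

text \<open>With \<open>p + q = 1\<close>, passing from \<open>n\<close> to \<open>n + 1\<close> changes the difference by
  \<open>- p * q * (p^(n-1) - q^(n-1))\<close>.\<close>

lemma power_diff_le_diff:
  fixes p q :: real
  assumes "0 \<le> q" "q \<le> p" "p + q = 1"
  shows "p ^ Suc n - q ^ Suc n \<le> p - q"
proof (induction n)
  case (Suc n)
  have "p ^ Suc (Suc n) - q ^ Suc (Suc n)
      = (p + q) * (p ^ Suc n - q ^ Suc n) - p * q * (p ^ n - q ^ n)"
    by (simp add: algebra_simps)
  also have "\<dots> \<le> p ^ Suc n - q ^ Suc n"
    using assms power_mono[of q p n] by simp
  finally show ?case using Suc by simp
qed simp

theorem theorem1p2:
  fixes p q :: real and n :: nat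
  assumes "0 < q" and "q < 1 / 2" and "n \<ge> 2" and "p = 1 - q"
  shows "p ^ n * (1 + q ^ n - p ^ n) * bin_entropy (q ^ n)
       > q ^ n * (1 + p ^ n - q ^ n) * bin_entropy (p ^ n)"
proof -
  define x y d where "x = q ^ n" and "y = p ^ n" and "d = y - x"
  have p: "0 < p" "p < 1" "q < p" using assms by auto
  have x: "0 < x" and y: "0 < y" "y < 1"
    using assms p by (auto simp: x_def y_def power_less_one_iff)
  have ratio: "p / q * (bin_entropy y / y) < bin_entropy x / x"
    using bin_entropy_powr_ratio[of q p "real n"] assms p
    by (simp add: powr_realpow x_def y_def)
  have "d \<le> p - q"
    using power_diff_le_diff[of q p "n - 1"] assms by (simp add: d_def x_def y_def)
  moreover have "p * (1 - d) - q * (1 + d) = p - q - (p + q) * d"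
    by (simp add: algebra_simps)
  moreover have "p + q = 1"
    using assms by simp
  ultimately have "q * (1 + d) \<le> p * (1 - d)"
    by simp
  then have "1 + d \<le> (1 - d) * (p / q)"
    using \<open>0 < q\<close> by (simp add: field_simps)
  moreover have "0 < bin_entropy y / y"
    using bin_entropy_pos[OF y] y by simp
  ultimately have "(1 + d) * (bin_entropy y / y) \<le> (1 - d) * (p / q * (bin_entropy y / y))"
    by (metis mult.assoc mult_right_mono less_imp_le)
  also have "\<dots> < (1 - d) * (bin_entropy x / x)"
    using ratio x y by (intro mult_strict_left_mono) (auto simp: d_def)
  finally have "x * (1 + d) * bin_entropy y < y * (1 - d) * bin_entropy x"
    using x y by (simp add: field_simps)
  then show ?thesis by (simp add: x_def y_def d_def algebra_simps)
qed

end
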